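(* (Fundamental Theorem of Finance.) Consider a financial model driven by a piecewise smooth Markov propagator $U_m$ on $A_m$ over $[T,T']$, with asset price processes $A_m^k(y_\cdot,t)$, $k=1,\dots,n$, and money-market account $A_m^0=B_m$. If there is an equivalent measure with respect to which all discounted asset price processes $\tilde A_m^k=A_m^k/B_m$, $k=0,\dots,n$, are martingales, then: (i) the discounted value process of any self-financing trading strategy is a martingale under the same equivalent measure; (ii) there is no arbitrage. Conversely, if there is no arbitrage, then there exists a measure change under which all discounted asset price processes become martingales.
   Context: Lattice and paths. $h_m=2^{-m}$; $A_m\subset h_m\mathbb{Z}^d$ is a finite set; $[T,T']$ is a finite time interval. Paths $y_\cdot:[T,T']\to A_m$ are piecewise constant, right-continuous, with finitely many jumps; $y_{t-0}=\lim_{\delta t\downarrow0}y_{t-\delta t}$. A non-anticipatory path functional (adapted process) is a family $F(y_\cdot,t)$ with $F(y_\cdot,t)=F(y'_\cdot,t)$ whenever $y_s=y'_s$ for all $s\le t$. For $\bar y\in A_m$, $\mathrm{Ext}_t(y_\cdot,\bar y)$ denotes the path equal to $y_s$ for $s<t$ and to $\bar y$ for $s\ge t$. Piecewise smooth Markov propagators. Given $T=t_0<t_1<\dots<t_N=T'$, such a propagator $U_m$ is specified by smooth families of Markov generators $\mathcal{L}^i_m(y_1,y_2;t)$ on $[t_i,t_{i+1})$ (off-diagonal entries $\ge0$, rows summing to $0$), and stochastic matrices $U_m^i(y_1,y_2)$ at the times $t_i$, $i\ge1$; the propagator is the path-ordered exponential of the generator between the $t_i$, multiplied on the right by the matrix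 $U^i_m$ upon reaching the time $t_i$. Write $\mathcal{L}(y_1,y_2;t)$ for the generator in force at time $t$. The attainable set $\mathcal{D}_m(U,t,y)$ is $\{\bar y:\mathcal{L}^i_m(y,\bar y;t)>0\}$ if $t\in(t_i,t_{i+1})$ and $\{\bar y: U^i_m(y,\bar y)>0\}$ if $t=t_i$. Two propagators $U,U'$ are equivalent if $\mathcal{D}_m(U,t,y)=\mathcal{D}_m(U',t,y)$ for all $t$ and $y$; an equivalent measure is the path measure of an equivalent propagator. Measure change. A family of functions $G_m^{yt}(y')\ge0$, indexed by $y\in A_m$, $t\in[T,T']$, strictly positive for $y'\in\mathcal{D}_m(U,t,y)$ (and at $y'=y$) and zero otherwise; it transforms the generator into the equivalent one $$\mathcal{L}'(y,y';t)=\frac{1}{G_m^{yt}(y)}\mathcal{L}(y,y';t)G_m^{yt}(y')-\frac{1}{G_m^{yt}(y)}(\mathcal{L}(t)G_m^{yt})(y)\,\delta_{yy'}.$$ Martingales. $F_t$ is a martingale under a propagator with generator $\mathcal{L}$ if for all $t$ $$\frac{\partial}{\partial t}F(\mathrm{Ext}_t(y_\cdot,y_{t-0}),t)+\sum_{\bar y\in\mathcal{D}_m(U,t,y_t)}\mathcal{L}(y_t,\bar y;t)\big(F(\mathrm{Ext}_t(y_\cdot,\bar y),t)-F(\mathrm{Ext}_t(y_\cdot,y_{t-0}),t)\big)=0.$$ Monotonicity. $F_t$ is increasing at time $t$ if (a) $F(\mathrm{Ext}_t(y_\cdot,\bar y),t)-F(\mathrm{Ext}_t(y_\cdot,y_{t-0}),t)\ge0$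 for all $\bar y\in\mathcal{D}_m(U,t,y_{t-0})$; (b) $\frac{\partial}{\partial s}F(\mathrm{Ext}_s(y_\cdot,y_{t-0}),s)\big|_{s=t}\ge0$; and (c) at each lattice point and time, either (a) is strict for at least one attainable $\bar y$ or (b) is strict. If (a), (b) hold but (c) may fail, it is non-decreasing. Financial model. Adapted processes $A_m^k(y_\cdot,t)$, $k=1,\dots,n$ (asset prices), and a non-decreasing (positive) adapted process $B_m(y_\cdot,t)=A^0_m(y_\cdot,t)$ (money-market account); $\tilde A^k_m=A^k_m/B_m$. A trading strategy is a family of adapted processes $\zeta^k_m(y_\cdot,t)$, $k=0,\dots,n$; its discounted value process is $\tilde\Pi_m(y_\cdot,t)=\sum_{k=0}^n\zeta^k_m(y_\cdot,t)\tilde A^k_m(y_\cdot,t)$. It is self-financing if $$\sum_{k=0}^n\frac{\partial\zeta^k_m}{\partial t}(\mathrm{Ext}_t(y_\cdot,y_{t-0}),t)\,\tilde A^k_m(\mathrm{Ext}_t(y_\cdot,y_{t-0}),t)=0$$ and, for all $\bar y\in\mathcal{D}_m(U,t,y_t)$, $$\sum_{k=0}^n\big(\zeta^k_m(\mathrm{Ext}_t(y_\cdot,\bar y),t)-\zeta^k_m(\mathrm{Ext}_t(y_\cdot,y_{t-0}),t)\big)\tilde A^k_m(\mathrm{Ext}_t(y_\cdot,\bar y),t)=0.$$ A self-financing strategy is an arbitrage at time $t$ if $\tilde\Pi_m(y_\cdot,t)$ is increasing at time $t$; there is no arbitrage if no self-financing strategy is an arbitrage at any time.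
   Formalization: In the converse the measure change G may depend on the path before t (indexed by lattice point and t only if discounted-price increments depend on the lattice point up to a common positive factor); at grid times t_i the matrix U^i replaces the generator and the time derivative is dropped. *)

theory Defs
  imports "HOL-Analysis.Analysis"
begin

section \<open>Lattice, time grid and paths\<close>

definition scaled_lattice :: "nat \<Rightarrow> (real ^ 'd) set" where
  "scaled_lattice m = {x. \<forall>i. \<exists>z::int. x $ i = of_int z * (1/2) ^ m}"

text \<open>The state space together with the time grid
  \<open>T = times 0 < times 1 < \<dots> < times steps = T'\<close>.\<close>

record 'p frame =
  lattice :: "'p set"
  steps :: nat
  times :: "nat \<Rightarrow> real"

definition frame :: "nat \<Rightarrow> (real ^ 'd) frame \<Rightarrow> bool" where
  "frame m S \<longleftrightarrow> finite (lattice S) \<and> lattice S \<subseteq> scaled_lattice m \<and> 0 < steps S \<and>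
     (\<forall>i<steps S. times S i < times S (Suc i))"

abbreviation initial :: "'p frame \<Rightarrow> real" where
  "initial S \<equiv> times S 0"

abbreviation final :: "'p frame \<Rightarrow> real" where
  "final S \<equiv> times S (steps S)"

definition grid :: "'p frame \<Rightarrow> real set" where
  "grid S = times S ` {..steps S}"

type_synonym 'p path = "real \<Rightarrow> 'p"
type_synonym 'p process = "'p path \<Rightarrow> real \<Rightarrow> real"

text \<open>Right-continuous step paths: \<open>J\<close> is a finite set containing all jump times, and
  \<open>y\<close> is constant on every \<open>[s, u]\<close> such that \<open>(s, u]\<close> avoids \<open>J\<close>.
  Values of \<open>y\<close> outside the time interval are irrelevant.\<close>

definition is_path :: "'p frame \<Rightarrow> 'p path \<Rightarrow> bool" where
  "is_path S y \<longleftrightarrow> y ` {initial S..final S} \<subseteq> lattice S \<and>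
     (\<exists>J. finite J \<and> (\<forall>s u. initial S \<le> s \<longrightarrow> s \<le> u \<longrightarrow> u \<le> final S \<longrightarrow>
        J \<inter> {s<..u} = {} \<longrightarrow> y s = y u))"

definition left_lim :: "('p::t2_space) path \<Rightarrow> real \<Rightarrow> 'p" where
  "left_lim y t = Lim (at_left t) y"

definition Ext :: "real \<Rightarrow> 'p path \<Rightarrow> 'p \<Rightarrow> 'p path" where
  "Ext t y b = (\<lambda>s. if s < t then y s else b)"

abbreviation frozen :: "real \<Rightarrow> ('p::t2_space) path \<Rightarrow> 'p path" where
  "frozen t y \<equiv> Ext t y (left_lim y t)"

definition adapted :: "'p frame \<Rightarrow> 'p process \<Rightarrow> bool" where
  "adapted S F \<longleftrightarrow> (\<forall>y y' t. is_path S y \<longrightarrow> is_path S y' \<longrightarrow> t \<in> {initial S..final S} \<longrightarrow>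
     (\<forall>s\<in>{initial S..t}. y s = y' s) \<longrightarrow> F y t = F y' t)"

text \<open>Adapted processes regular enough for their time derivatives to be meaningful:
  along a path which does not jump they are differentiable at times off the grid, where the
  dynamics is smooth, and have no predictable jump at the grid times, where the generator may
  switch and no derivative need exist.\<close>

definition process :: "('p::t2_space) frame \<Rightarrow> 'p process \<Rightarrow> bool" where
  "process S F \<longleftrightarrow> adapted S F \<and>
     (\<forall>y t. is_path S y \<longrightarrow> t \<in> {initial S<..final S} \<longrightarrow>
        (if t \<in> grid S then continuous (at_left t) (\<lambda>s. F (frozen t y) s)
         else (\<lambda>s. F (frozen t y) s) differentiable (at t)))"

text \<open>The derivative of \<open>s \<mapsto> F (Ext s y (left_lim y t)) s\<close> at \<open>s = t\<close>, the path being
  continued past \<open>t\<close> by its left limit (this only matters if \<open>y\<close> itself jumps at \<open>t\<close>).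
  At a grid time the state moves instantaneously, according to a stochastic matrix; no time
  elapses and there is no drift.\<close>

definition drift :: "('p::t2_space) frame \<Rightarrow> 'p process \<Rightarrow> 'p path \<Rightarrow> real \<Rightarrow> real" where
  "drift S F y t = (if t \<in> grid S then 0 else deriv (\<lambda>s. F (frozen t y) s) t)"

definition jump :: "('p::t2_space) process \<Rightarrow> 'p path \<Rightarrow> real \<Rightarrow> 'p \<Rightarrow> real" where
  "jump F y t b = F (Ext t y b) t - F (frozen t y) t"


section \<open>Piecewise smooth Markov propagators\<close>

text \<open>Infinitely differentiable on an interval, one-sidedly at the endpoints it contains:
  \<open>D k\<close> is the \<open>k\<close>-th derivative.\<close>

definition smooth_on :: "real set \<Rightarrow> (real \<Rightarrow> real) \<Rightarrow> bool" where
  "smooth_on I f \<longleftrightarrow> (\<exists>D :: nat \<Rightarrow> real \<Rightarrow> real. (\<forall>t\<in>I. D 0 t = f t) \<and>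
     (\<forall>k. \<forall>t\<in>I. (D k has_real_derivative D (Suc k) t) (at t within I)))"

definition markov_generator :: "'p set \<Rightarrow> ('p \<Rightarrow> 'p \<Rightarrow> real) \<Rightarrow> bool" where
  "markov_generator X L \<longleftrightarrow> (\<forall>a\<in>X. \<forall>b\<in>X. a \<noteq> b \<longrightarrow> 0 \<le> L a b) \<and> (\<forall>a\<in>X. (\<Sum>b\<in>X. L a b) = 0)"

definition stochastic_matrix :: "'p set \<Rightarrow> ('p \<Rightarrow> 'p \<Rightarrow> real) \<Rightarrow> bool" where
  "stochastic_matrix X P \<longleftrightarrow> (\<forall>a\<in>X. \<forall>b\<in>X. 0 \<le> P a b) \<and> (\<forall>a\<in>X. (\<Sum>b\<in>X. P a b) = 1)"

record 'p propagator =
  generator :: "nat \<Rightarrow> real \<Rightarrow> 'p \<Rightarrow> 'p \<Rightarrow> real"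
  matrix :: "nat \<Rightarrow> 'p \<Rightarrow> 'p \<Rightarrow> real"

definition markov_propagator :: "'p frame \<Rightarrow> 'p propagator \<Rightarrow> bool" where
  "markov_propagator S U \<longleftrightarrow>
     (\<forall>i<steps S.
        (\<forall>a\<in>lattice S. \<forall>b\<in>lattice S.
           smooth_on {times S i..<times S (Suc i)} (\<lambda>t. generator U i t a b)) \<and>
        (\<forall>t\<in>{times S i..<times S (Suc i)}. markov_generator (lattice S) (generator U i t))) \<and>
     (\<forall>i\<in>{1..steps S}. stochastic_matrix (lattice S) (matrix U i))"

definition last_grid :: "'p frame \<Rightarrow> real \<Rightarrow> nat" where
  "last_grid S t = Max {i. i \<le> steps S \<and> times S i \<le> t}"

text \<open>What governs the motion at time \<open>t\<close>: the generator in force between grid times, the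
  stochastic matrix at a grid time.\<close>

definition kernel :: "'p frame \<Rightarrow> 'p propagator \<Rightarrow> real \<Rightarrow> 'p \<Rightarrow> 'p \<Rightarrow> real" where
  "kernel S U t = (if t \<in> grid S then matrix U (last_grid S t) else generator U (last_grid S t) t)"

definition attainable :: "'p frame \<Rightarrow> 'p propagator \<Rightarrow> real \<Rightarrow> 'p \<Rightarrow> 'p set" where
  "attainable S U t a = {b \<in> lattice S. 0 < kernel S U t a b}"

definition equivalent :: "'p frame \<Rightarrow> 'p propagator \<Rightarrow> 'p propagator \<Rightarrow> bool" where
  "equivalent S U U' \<longleftrightarrow>
     (\<forall>t\<in>{initial S<..final S}. \<forall>a\<in>lattice S. attainable S U t a = attainable S U' t a)"


section \<open>Martingales and measure changes\<close>

text \<open>The kernel \<open>K\<close> may depend on the path, as is needed after a measure change in a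
  path-dependent model. Kernels are evaluated at the state just before \<open>t\<close>.\<close>

definition martingale_wrt ::
  "('p::t2_space) frame \<Rightarrow> ('p path \<Rightarrow> real \<Rightarrow> 'p \<Rightarrow> 'p \<Rightarrow> real) \<Rightarrow> 'p process \<Rightarrow> bool" where
  "martingale_wrt S K F \<longleftrightarrow> process S F \<and>
     (\<forall>y t. is_path S y \<longrightarrow> t \<in> {initial S<..final S} \<longrightarrow>
        drift S F y t +
          (\<Sum>b\<in>{b \<in> lattice S. 0 < K y t (left_lim y t) b}. K y t (left_lim y t) b * jump F y t b) = 0)"

definition martingale :: "('p::t2_space) frame \<Rightarrow> 'p propagator \<Rightarrow> 'p process \<Rightarrow> bool" where
  "martingale S U = martingale_wrt S (\<lambda>_. kernel S U)"

text \<open>The functions are indexed by time and by the path before it, of which the current lattice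
  point \<open>left_lim y t\<close> is part.\<close>

definition measure_change ::
  "('p::t2_space) frame \<Rightarrow> 'p propagator \<Rightarrow> ('p path \<Rightarrow> real \<Rightarrow> 'p \<Rightarrow> real) \<Rightarrow> bool" where
  "measure_change S U G \<longleftrightarrow>
     (\<forall>y t. is_path S y \<longrightarrow> t \<in> {initial S<..final S} \<longrightarrow>
        (\<forall>b\<in>lattice S.
           if b \<in> insert (left_lim y t) (attainable S U t (left_lim y t))
           then 0 < G y t b else G y t b = 0)) \<and>
     (\<forall>y y' t. is_path S y \<longrightarrow> is_path S y' \<longrightarrow> t \<in> {initial S<..final S} \<longrightarrow>
        (\<forall>s\<in>{initial S..<t}. y s = y' s) \<longrightarrow> G y t = G y' t)"

text \<open>Generators are transformed in the usual way; a stochastic matrix is reweighted by the same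
  functions and its rows renormalised to sum to one.\<close>

definition changed_kernel ::
  "'p frame \<Rightarrow> 'p propagator \<Rightarrow> ('p path \<Rightarrow> real \<Rightarrow> 'p \<Rightarrow> real) \<Rightarrow>
     'p path \<Rightarrow> real \<Rightarrow> 'p \<Rightarrow> 'p \<Rightarrow> real" where
  "changed_kernel S U G y t a b =
     (if t \<in> grid S
      then kernel S U t a b * G y t b / (\<Sum>c\<in>lattice S. kernel S U t a c * G y t c)
      else 1 / G y t a * kernel S U t a b * G y t b
           - 1 / G y t a * (\<Sum>c\<in>lattice S. kernel S U t a c * G y t c) * (if a = b then 1 else 0))"


section \<open>Monotonicity and the financial model\<close>

definition nondecreasing_at ::
  "('p::t2_space) frame \<Rightarrow> 'p propagator \<Rightarrow> 'p process \<Rightarrow> 'p path \<Rightarrow> real \<Rightarrow> bool" where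
  "nondecreasing_at S U F y t \<longleftrightarrow>
     (\<forall>b\<in>attainable S U t (left_lim y t). 0 \<le> jump F y t b) \<and> 0 \<le> drift S F y t"

definition increasing_at ::
  "('p::t2_space) frame \<Rightarrow> 'p propagator \<Rightarrow> 'p process \<Rightarrow> 'p path \<Rightarrow> real \<Rightarrow> bool" where
  "increasing_at S U F y t \<longleftrightarrow> nondecreasing_at S U F y t \<and>
     ((\<exists>b\<in>attainable S U t (left_lim y t). 0 < jump F y t b) \<or> 0 < drift S F y t)"

text \<open>\<open>A 0\<close> is the money-market account, \<open>A 1, \<dots>, A n\<close> are the asset prices.\<close>

definition financial_model ::
  "('p::t2_space) frame \<Rightarrow> 'p propagator \<Rightarrow> nat \<Rightarrow> (nat \<Rightarrow> 'p process) \<Rightarrow> bool" where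
  "financial_model S U n A \<longleftrightarrow> (\<forall>k\<le>n. process S (A k)) \<and>
     (\<forall>y t. is_path S y \<longrightarrow> t \<in> {initial S..final S} \<longrightarrow> 0 < A 0 y t) \<and>
     (\<forall>y t. is_path S y \<longrightarrow> t \<in> {initial S<..final S} \<longrightarrow> nondecreasing_at S U (A 0) y t)"

definition discounted :: "(nat \<Rightarrow> 'p process) \<Rightarrow> nat \<Rightarrow> 'p process" where
  "discounted A k y t = A k y t / A 0 y t"

definition discounted_value ::
  "nat \<Rightarrow> (nat \<Rightarrow> 'p process) \<Rightarrow> (nat \<Rightarrow> 'p process) \<Rightarrow> 'p process" where
  "discounted_value n A \<zeta> y t = (\<Sum>k\<le>n. \<zeta> k y t * discounted A k y t)"

definition self_financing ::
  "('p::t2_space) frame \<Rightarrow> 'p propagator \<Rightarrow> nat \<Rightarrow> (nat \<Rightarrow> 'p process) \<Rightarrow> (nat \<Rightarrow> 'p process) \<Rightarrow> bool" where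
  "self_financing S U n A \<zeta> \<longleftrightarrow> (\<forall>k\<le>n. process S (\<zeta> k)) \<and>
     (\<forall>y t. is_path S y \<longrightarrow> t \<in> {initial S<..final S} \<longrightarrow>
        (\<Sum>k\<le>n. drift S (\<zeta> k) y t * discounted A k (frozen t y) t) = 0 \<and>
        (\<forall>b\<in>attainable S U t (left_lim y t).
           (\<Sum>k\<le>n. jump (\<zeta> k) y t b * discounted A k (Ext t y b) t) = 0))"

text \<open>Monotonicity is a condition at a time and on the path before it. A strategy is an arbitrage
  at time \<open>t\<close> if its value is increasing there in some such scenario.\<close>

definition arbitrage_at ::
  "('p::t2_space) frame \<Rightarrow> 'p propagator \<Rightarrow> nat \<Rightarrow> (nat \<Rightarrow> 'p process) \<Rightarrow> (nat \<Rightarrow> 'p process) \<Rightarrow>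
     real \<Rightarrow> bool" where
  "arbitrage_at S U n A \<zeta> t \<longleftrightarrow> self_financing S U n A \<zeta> \<and>
     (\<exists>y. is_path S y \<and> increasing_at S U (discounted_value n A \<zeta>) y t)"

definition no_arbitrage ::
  "('p::t2_space) frame \<Rightarrow> 'p propagator \<Rightarrow> nat \<Rightarrow> (nat \<Rightarrow> 'p process) \<Rightarrow> bool" where
  "no_arbitrage S U n A \<longleftrightarrow> \<not> (\<exists>\<zeta>. \<exists>t\<in>{initial S<..final S}. arbitrage_at S U n A \<zeta> t)"

text \<open>Local increments of the discounted prices depend on the path only through the lattice point
  just before \<open>t\<close>, up to a common positive factor. The factor accounts for the path-dependent
  value of the account: the condition holds if the \<open>A k\<close> (\<open>1 \<le> k\<close>) are functions of state and
  time, and so are the relative increments of \<open>A 0\<close>.\<close>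

definition state_dependent ::
  "('p::t2_space) frame \<Rightarrow> 'p propagator \<Rightarrow> nat \<Rightarrow> (nat \<Rightarrow> 'p process) \<Rightarrow> bool" where
  "state_dependent S U n A \<longleftrightarrow>
     (\<forall>y y' t. is_path S y \<longrightarrow> is_path S y' \<longrightarrow> t \<in> {initial S<..final S} \<longrightarrow>
        left_lim y t = left_lim y' t \<longrightarrow>
        (\<exists>c>0. \<forall>k\<le>n. drift S (discounted A k) y t = c * drift S (discounted A k) y' t \<and>
           (\<forall>b\<in>attainable S U t (left_lim y t).
              jump (discounted A k) y t b = c * jump (discounted A k) y' t b)))"

end

theory Submission
  imports Defs
begin

text \<open>The theorem is a pointwise statement about the increments of the discounted prices. Just
  before a time \<open>t\<close> on a path \<open>y\<close>, these form a finite family of vectors in \<open>\<real>\<^bsup>n + 1\<^esup>\<close>: the drift,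
  and one jump for every attainable lattice point.

  For a self-financing strategy the changes of the holdings cancel from the product rule, so the
  increments of the discounted value are the linear combination of the price increments whose
  coefficients are the holdings just before \<open>t\<close> (\<open>drift_discounted_value\<close>,
  \<open>jump_discounted_value\<close>). The martingale equation is linear in the increments and therefore
  passes from the prices to the value. It also equates a combination of increments with positive
  coefficients to zero, so that the increments of a martingale cannot all be non-negative unless
  they all vanish, and there is no arbitrage.

  Conversely, a constant strategy is self-financing, and its value has as increments the inner
  products of the price increments with an arbitrary vector. If there is no arbitrage, no vector
  has non-negative inner products with all the increments and a positive one with some. By
  Stiemke's alternative (\<open>stiemke\<close>, a consequence of Farkas' lemma) the increments then satisfy
  a linear relation with positive coefficients. These coefficients, divided by the kernel, are
  the measure change (\<open>tilt_exists\<close>, \<open>changed_kernel_martingale\<close>).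

  It remains to choose the coefficients in an adapted way, and as a function of the lattice point
  and time if the model permits. Whether given coefficients solve the relation depends only on the
  increments up to a common positive factor, so one choice serves a whole class of
  paths (\<open>tilt_cong\<close>). Paths which agree before \<open>t\<close> lie in one class, and so do, in a
  state-dependent model, paths with the same left limit.\<close>


section \<open>Linear inequalities\<close>

text \<open>Induction on the number of inequalities. If the last one, \<open>v j\<close>, is essential,
  there is a vector \<open>z\<close> that violates only this inequality and \<open>u\<close>. Moving along \<open>z\<close> projects
  onto the hyperplane on which \<open>v j\<close> vanishes; the induction hypothesis applies to the pulled-back
  functionals, and the coefficient of \<open>v j\<close> that results is non-negative since \<open>u\<close> is negative
  at \<open>z\<close>.\<close>

lemma farkas:
  fixes v :: "'i \<Rightarrow> 'k \<Rightarrow> real" and u :: "'k \<Rightarrow> real"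
  assumes "finite I" and "finite K"
    and "\<And>x. (\<And>i. i \<in> I \<Longrightarrow> 0 \<le> (\<Sum>k\<in>K. x k * v i k)) \<Longrightarrow> 0 \<le> (\<Sum>k\<in>K. x k * u k)"
  shows "\<exists>c. (\<forall>i\<in>I. 0 \<le> c i) \<and> (\<forall>k\<in>K. u k = (\<Sum>i\<in>I. c i * v i k))"
  using assms(1,3)
proof (induction I arbitrary: v u rule: finite_induct)
  case empty
  have "0 \<le> (\<Sum>k\<in>K. - u k * u k)"
    using empty[of "\<lambda>k. - u k"] by simp
  then have "(\<Sum>k\<in>K. u k * u k) = 0"
    by (intro antisym sum_nonneg) (simp_all add: sum_negf)
  then have "\<forall>k\<in>K. u k = 0"
    using assms(2) by (simp add: sum_nonneg_eq_0_iff)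
  then show ?case
    by simp
next
  case (insert j I)
  let ?f = "\<lambda>x w. \<Sum>k\<in>K. x k * w k"
  show ?case
  proof (cases "\<forall>x. (\<forall>i\<in>I. 0 \<le> ?f x (v i)) \<longrightarrow> 0 \<le> ?f x u")
    case True
    then obtain c where c: "\<forall>i\<in>I. 0 \<le> c i" "\<forall>k\<in>K. u k = (\<Sum>i\<in>I. c i * v i k)"
      using insert.IH[of v u] by blast
    have "(\<Sum>i\<in>insert j I. (c(j := 0)) i * v i k) = (\<Sum>i\<in>I. c i * v i k)" for k
      using insert.hyps by (auto intro!: sum.cong)
    then show ?thesis
      using c by (intro exI[of _ "c(j := 0)"]) auto
  next
    case False
    then obtain z0 where z0: "\<And>i. i \<in> I \<Longrightarrow> 0 \<le> ?f z0 (v i)" "?f z0 u < 0"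
      by (auto simp: not_le)
    then have neg: "?f z0 (v j) < 0"
      using insert.prems[of z0] by (metis insert_iff not_le)
    define z where "z k = z0 k / - ?f z0 (v j)" for k
    have f_z: "?f z w = ?f z0 w / - ?f z0 (v j)" for w
      by (simp add: z_def sum_divide_distrib sum_negf)
    have z: "\<And>i. i \<in> I \<Longrightarrow> 0 \<le> ?f z (v i)" "?f z u < 0" "?f z (v j) = - 1"
      using z0 neg unfolding f_z by (auto simp: divide_simps)
    define v' where "v' i k = v i k + ?f z (v i) * v j k" for i k
    define u' where "u' k = u k + ?f z u * v j k" for k
    \<comment> \<open>The projection \<open>x \<mapsto> x + (x \<bullet> v j) z\<close> is the transpose of \<open>v \<mapsto> v'\<close>.\<close>
    have proj: "?f (\<lambda>k. x k + ?f x (v j) * z k) w = ?f x (\<lambda>k. w k + ?f z w * v j k)" for x w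
    proof -
      have "?f (\<lambda>k. x k + ?f x (v j) * z k) w = ?f x w + ?f x (v j) * ?f z w"
        by (simp add: distrib_right sum.distrib sum_distrib_left mult.assoc)
      also have "\<dots> = ?f x (\<lambda>k. w k + ?f z w * v j k)"
        by (simp add: distrib_left sum.distrib sum_distrib_left mult.left_commute mult.commute)
      finally show ?thesis .
    qed
    have "0 \<le> ?f x u'" if x: "\<And>i. i \<in> I \<Longrightarrow> 0 \<le> ?f x (v' i)" for x
    proof -
      have "0 \<le> ?f (\<lambda>k. x k + ?f x (v j) * z k) (v i)" if "i \<in> insert j I" for i
      proof (cases "i = j")
        case True
        then show ?thesis
          unfolding proj by (simp add: z)
      next
        case False
        then show ?thesis
          using that x[of i] unfolding proj v'_def by simp
      qed
      from insert.prems[OF this] show ?thesis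
        unfolding proj u'_def .
    qed
    then obtain c where c: "\<forall>i\<in>I. 0 \<le> c i" "\<forall>k\<in>K. u' k = (\<Sum>i\<in>I. c i * v' i k)"
      using insert.IH[of v' u'] by blast
    define d where "d = (\<Sum>i\<in>I. c i * ?f z (v i)) - ?f z u"
    have "0 \<le> (\<Sum>i\<in>I. c i * ?f z (v i))"
      using c(1) z(1) by (meson sum_nonneg mult_nonneg_nonneg)
    then have "0 \<le> d"
      using z(2) by (simp add: d_def)
    moreover have "u k = d * v j k + (\<Sum>i\<in>I. c i * v i k)" if "k \<in> K" for k
    proof -
      have "u k + ?f z u * v j k = (\<Sum>i\<in>I. c i * v i k) + (\<Sum>i\<in>I. c i * ?f z (v i)) * v j k"
        using c(2) that
        by (simp add: u'_def v'_def distrib_left sum.distrib sum_distrib_right mult.assoc)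
      then show ?thesis
        by (simp add: d_def algebra_simps)
    qed
    moreover have "(\<Sum>i\<in>insert j I. (c(j := d)) i * v i k) = d * v j k + (\<Sum>i\<in>I. c i * v i k)" for k
      using insert.hyps by (auto intro!: sum.cong)
    ultimately show ?thesis
      using c(1) by (intro exI[of _ "c(j := d)"]) auto
  qed
qed

text \<open>By Farkas' lemma every \<open>- v j\<close> is a non-negative combination of the \<open>v i\<close>; moving \<open>v j\<close> to
  the other side and adding these relations over all \<open>j\<close> makes every coefficient at least one.\<close>

lemma stiemke:
  fixes v :: "'i \<Rightarrow> 'k \<Rightarrow> real"
  assumes "finite I" and "finite K"
    and alt: "\<And>x i. (\<And>i. i \<in> I \<Longrightarrow> 0 \<le> (\<Sum>k\<in>K. x k * v i k)) \<Longrightarrow> i \<in> I \<Longrightarrow>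
      (\<Sum>k\<in>K. x k * v i k) \<le> 0"
  shows "\<exists>w. (\<forall>i\<in>I. 0 < w i) \<and> (\<forall>k\<in>K. (\<Sum>i\<in>I. w i * v i k) = 0)"
proof -
  have "\<exists>c. (\<forall>i\<in>I. 0 \<le> c i) \<and> (\<forall>k\<in>K. - v j k = (\<Sum>i\<in>I. c i * v i k))" if "j \<in> I" for j
    using alt[OF _ that] by (intro farkas[OF assms(1,2)]) (simp add: sum_negf)
  then obtain c where c: "\<And>j i. j \<in> I \<Longrightarrow> i \<in> I \<Longrightarrow> 0 \<le> c j i"
    "\<And>j k. j \<in> I \<Longrightarrow> k \<in> K \<Longrightarrow> (\<Sum>i\<in>I. c j i * v i k) = - v j k"
    by metis
  define w where "w i = 1 + (\<Sum>j\<in>I. c j i)" for i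
  have "0 < w i" if "i \<in> I" for i
    using c(1) that unfolding w_def by (intro add_pos_nonneg sum_nonneg) auto
  moreover have "(\<Sum>i\<in>I. w i * v i k) = 0" if "k \<in> K" for k
  proof -
    have "(\<Sum>i\<in>I. w i * v i k) = (\<Sum>i\<in>I. v i k) + (\<Sum>i\<in>I. \<Sum>j\<in>I. c j i * v i k)"
      by (simp add: w_def distrib_right sum.distrib sum_distrib_right)
    also have "(\<Sum>i\<in>I. \<Sum>j\<in>I. c j i * v i k) = (\<Sum>j\<in>I. - v j k)"
      using c(2) that by (subst sum.swap) simp
    finally show ?thesis
      by (simp add: sum_negf)
  qed
  ultimately show ?thesis
    by blast
qed


section \<open>Paths and their left limits\<close>

lemma path_constant_before:
  assumes y: "is_path S y" and t: "t \<in> {initial S<..final S}"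
  shows "\<exists>p. \<exists>s\<in>{initial S..<t}. \<forall>u\<in>{s..<t}. y u = p"
proof -
  obtain J where J: "finite J" "\<And>s u. initial S \<le> s \<Longrightarrow> s \<le> u \<Longrightarrow> u \<le> final S \<Longrightarrow>
      J \<inter> {s<..u} = {} \<Longrightarrow> y s = y u"
    using y unfolding is_path_def by blast
  define J' where "J' = insert (initial S) (J \<inter> {initial S..<t})"
  have J': "finite J'" "J' \<noteq> {}"
    using J(1) by (auto simp: J'_def)
  have Max: "Max J' \<in> {initial S..<t}"
    using Max_in[OF J'] t by (auto simp: J'_def)
  moreover have "y u = y (Max J')" if u: "u \<in> {Max J'..<t}" for u
  proof -
    have "J \<inter> {Max J'<..u} = {}"
    proof (rule ccontr)
      assume "J \<inter> {Max J'<..u} \<noteq> {}"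
      then obtain x where "x \<in> J" "Max J' < x" "x \<le> u"
        by auto
      moreover from this have "x \<in> J'"
        using Max u by (auto simp: J'_def)
      ultimately show False
        using Max_ge[OF J'(1)] by fastforce
    qed
    then show ?thesis
      using J(2)[of "Max J'" u] Max u t by auto
  qed
  ultimately show ?thesis
    by blast
qed

lemma left_lim_attained:
  fixes y :: "('p::t2_space) path"
  assumes "is_path S y" and "t \<in> {initial S<..final S}"
  obtains s where "s \<in> {initial S..<t}" "\<And>u. u \<in> {s..<t} \<Longrightarrow> y u = left_lim y t"
proof -
  obtain p s where s: "s \<in> {initial S..<t}" "\<And>u. u \<in> {s..<t} \<Longrightarrow> y u = p"
    using path_constant_before[OF assms] by blast
  have "eventually (\<lambda>u. y u = p) (at_left t)"
    using s by (intro eventually_at_leftI[of s]) auto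
  then have "left_lim y t = p"
    unfolding left_lim_def by (intro tendsto_Lim tendsto_eventually) auto
  then show thesis
    using s that by auto
qed

lemma left_lim_in_lattice:
  fixes y :: "('p::t2_space) path"
  assumes "is_path S y" and "t \<in> {initial S<..final S}"
  shows "left_lim y t \<in> lattice S"
proof -
  obtain s where s: "s \<in> {initial S..<t}" "\<And>u. u \<in> {s..<t} \<Longrightarrow> y u = left_lim y t"
    using left_lim_attained[OF assms] by blast
  then have "left_lim y t = y s"
    by force
  moreover have "y s \<in> lattice S"
    using assms s(1) by (auto simp: is_path_def)
  ultimately show ?thesis
    by simp
qed

lemma left_lim_cong:
  fixes y y' :: "('p::t2_space) path"
  assumes "is_path S y" and "is_path S y'" and t: "t \<in> {initial S<..final S}"
    and eq: "\<forall>s\<in>{initial S..<t}. y s = y' s"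
  shows "left_lim y t = left_lim y' t"
proof -
  obtain s where s: "s \<in> {initial S..<t}" "\<And>u. u \<in> {s..<t} \<Longrightarrow> y u = left_lim y t"
    using left_lim_attained[OF assms(1) t] by blast
  obtain s' where s': "s' \<in> {initial S..<t}" "\<And>u. u \<in> {s'..<t} \<Longrightarrow> y' u = left_lim y' t"
    using left_lim_attained[OF assms(2) t] by blast
  have "max s s' \<in> {s..<t}" "max s s' \<in> {s'..<t}" "max s s' \<in> {initial S..<t}"
    using s(1) s'(1) by auto
  then show ?thesis
    using s(2) s'(2) eq by metis
qed

lemma is_path_Ext:
  assumes y: "is_path S y" and b: "b \<in> lattice S"
  shows "is_path S (Ext t y b)"
proof -
  obtain J where J: "finite J" "\<And>s u. initial S \<le> s \<Longrightarrow> s \<le> u \<Longrightarrow> u \<le> final S \<Longrightarrow>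
      J \<inter> {s<..u} = {} \<Longrightarrow> y s = y u"
    using y unfolding is_path_def by blast
  have "Ext t y b s = Ext t y b u"
    if "initial S \<le> s" "s \<le> u" "u \<le> final S" "insert t J \<inter> {s<..u} = {}" for s u
  proof -
    have "u < t \<or> t \<le> s"
      using that(4) by auto
    then show ?thesis
      using that J(2)[of s u] by (auto simp: Ext_def)
  qed
  then have "\<exists>J. finite J \<and> (\<forall>s u. initial S \<le> s \<longrightarrow> s \<le> u \<longrightarrow> u \<le> final S \<longrightarrow>
      J \<inter> {s<..u} = {} \<longrightarrow> Ext t y b s = Ext t y b u)"
    using J(1) by (intro exI[of _ "insert t J"]) auto
  moreover have "Ext t y b ` {initial S..final S} \<subseteq> lattice S"
    using y b by (auto simp: is_path_def Ext_def)
  ultimately show ?thesis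
    unfolding is_path_def by blast
qed

lemma is_path_frozen:
  fixes y :: "('p::t2_space) path"
  assumes "is_path S y" and "t \<in> {initial S<..final S}"
  shows "is_path S (frozen t y)"
  using is_path_Ext[OF assms(1) left_lim_in_lattice[OF assms]] .

lemma adapted_Ext_cong:
  assumes "adapted S F" and "is_path S y" and "is_path S y'" and "b \<in> lattice S"
    and "\<forall>s\<in>{initial S..<t}. y s = y' s" and "s \<in> {initial S..final S}"
  shows "F (Ext t y b) s = F (Ext t y' b) s"
proof -
  have "\<forall>u\<in>{initial S..s}. Ext t y b u = Ext t y' b u"
    using assms(5) by (simp add: Ext_def)
  then show ?thesis
    using assms(1,6) is_path_Ext[OF assms(2,4)] is_path_Ext[OF assms(3,4)]
    unfolding adapted_def by blast
qed

lemma jump_left_lim: "jump F y t (left_lim y t) = 0"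
  by (simp add: jump_def)

lemma interior_if_not_grid:
  assumes "t \<in> {initial S<..final S}" and "t \<notin> grid S"
  shows "t \<in> {initial S<..<final S}"
proof -
  have "final S \<in> grid S"
    by (simp add: grid_def)
  then show ?thesis
    using assms by (cases "t = final S") auto
qed

text \<open>Off the grid a neighbourhood of \<open>t\<close> lies inside the time interval, so the derivative is
  determined by values at which adaptedness has a say.\<close>

lemma increments_cong:
  fixes y y' :: "('p::t2_space) path"
  assumes F: "adapted S F" and y: "is_path S y" "is_path S y'" and t: "t \<in> {initial S<..final S}"
    and eq: "\<forall>s\<in>{initial S..<t}. y s = y' s"
  shows drift_cong: "drift S F y t = drift S F y' t"
    and jump_cong: "b \<in> lattice S \<Longrightarrow> jump F y t b = jump F y' t b"
proof -
  have lim: "left_lim y t = left_lim y' t"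
    using left_lim_cong[OF y t eq] .
  have lat: "left_lim y' t \<in> lattice S"
    using left_lim_in_lattice[OF y(2) t] .
  have frozen: "F (frozen t y) s = F (frozen t y') s" if "s \<in> {initial S..final S}" for s
    using adapted_Ext_cong[OF F y lat eq that] lim by simp
  show "drift S F y t = drift S F y' t"
  proof (cases "t \<in> grid S")
    case False
    then have "t \<in> {initial S<..<final S}"
      using interior_if_not_grid[OF t] by blast
    then have "eventually (\<lambda>s. s \<in> {initial S<..<final S}) (nhds t)"
      by (intro eventually_nhds_in_open) auto
    then have "eventually (\<lambda>s. F (frozen t y) s = F (frozen t y') s) (nhds t)"
      by eventually_elim (auto intro!: frozen)
    then show ?thesis
      using False by (simp add: drift_def deriv_cong_ev)
  qed (simp add: drift_def)
  show "jump F y t b = jump F y' t b" if "b \<in> lattice S"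
    using adapted_Ext_cong[OF F y that eq, of t] frozen[of t] t by (simp add: jump_def)
qed


section \<open>Increments of the discounted value\<close>

lemma process_cong:
  assumes "process S F" and "\<And>y t. F y t = G y t"
  shows "process S G"
proof -
  have "F = G"
    using assms(2) by (intro ext)
  then show ?thesis
    using assms(1) by simp
qed

lemma process_const: "process S (\<lambda>_ _. c)"
  by (auto simp: process_def adapted_def)

lemma process_mult:
  assumes "process S F" and "process S G"
  shows "process S (\<lambda>y t. F y t * G y t)"
proof -
  have "adapted S (\<lambda>y t. F y t * G y t)"
    using assms unfolding process_def adapted_def by metis
  then show ?thesis
    using assms unfolding process_def by (auto intro: continuous_mult)
qed

lemma process_sum:
  assumes F: "\<And>k. k \<in> K \<Longrightarrow> process S (F k)" and "finite K"
  shows "process S (\<lambda>y t. \<Sum>k\<in>K. F k y t)"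
proof -
  have "adapted S (F k)" if "k \<in> K" for k
    using F[OF that] by (simp add: process_def)
  then have "adapted S (\<lambda>y t. \<Sum>k\<in>K. F k y t)"
    unfolding adapted_def by (intro allI impI sum.cong refl) blast
  moreover have "if t \<in> grid S then continuous (at_left t) (\<lambda>s. \<Sum>k\<in>K. F k (frozen t y) s)
      else (\<lambda>s. \<Sum>k\<in>K. F k (frozen t y) s) differentiable (at t)"
    if yt: "is_path S y" "t \<in> {initial S<..final S}" for y t
  proof (cases "t \<in> grid S")
    case True
    then have "continuous (at_left t) (F k (frozen t y))" if "k \<in> K" for k
      using F[OF that] yt by (simp add: process_def)
    then show ?thesis
      using True by (simp add: continuous_sum)
  next
    case False
    then have "F k (frozen t y) differentiable (at t)" if "k \<in> K" for k
      using F[OF that] yt by (simp add: process_def)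
    then show ?thesis
      using False \<open>finite K\<close> by (simp add: differentiable_sum)
  qed
  ultimately show ?thesis
    by (simp add: process_def)
qed

lemma process_divide:
  fixes S :: "('p::t2_space) frame"
  assumes F: "process S F" and G: "process S G"
    and nz: "\<And>y t. is_path S y \<Longrightarrow> t \<in> {initial S..final S} \<Longrightarrow> G y t \<noteq> 0"
  shows "process S (\<lambda>y t. F y t / G y t)"
proof -
  have "adapted S (\<lambda>y t. F y t / G y t)"
    using F G unfolding process_def adapted_def by metis
  moreover have "G (frozen t y) t \<noteq> 0" if "is_path S y" "t \<in> {initial S<..final S}" for y t
    using nz is_path_frozen[OF that] that(2) by simp
  ultimately show ?thesis
    using F G unfolding process_def
    by (auto intro!: differentiable_divide continuous_at_within_divide)
qed

lemma process_discounted: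
  fixes S :: "('p::t2_space) frame"
  assumes A: "financial_model S U n A" and "k \<le> n"
  shows "process S (discounted A k)"
proof -
  have "process S (\<lambda>y t. A k y t / A 0 y t)"
  proof (rule process_divide)
    show "process S (A k)" "process S (A 0)"
      using assms by (simp_all add: financial_model_def)
    show "A 0 y t \<noteq> 0" if "is_path S y" "t \<in> {initial S..final S}" for y t
      using A that unfolding financial_model_def by (metis less_irrefl)
  qed
  then show ?thesis
    by (rule process_cong) (simp add: discounted_def)
qed

lemma process_discounted_value:
  fixes S :: "('p::t2_space) frame"
  assumes "financial_model S U n A" and "self_financing S U n A \<zeta>"
  shows "process S (discounted_value n A \<zeta>)"
proof -
  have "process S (\<lambda>y t. \<Sum>k\<le>n. \<zeta> k y t * discounted A k y t)"
  proof (intro process_sum process_mult)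
    show "process S (\<zeta> k)" "process S (discounted A k)" if "k \<in> {..n}" for k
      using assms that process_discounted by (simp_all add: self_financing_def)
  qed simp
  then show ?thesis
    by (rule process_cong) (simp add: discounted_value_def)
qed

lemma process_has_derivative:
  assumes "process S F" and "is_path S y" and "t \<in> {initial S<..final S}" and "t \<notin> grid S"
  shows "((\<lambda>s. F (frozen t y) s) has_real_derivative drift S F y t) (at t)"
  using assms unfolding process_def drift_def
  by (auto simp: DERIV_deriv_iff_real_differentiable)

text \<open>In the product rule, the terms in which the holdings vary add up to zero by
  self-financing.\<close>

lemma drift_discounted_value:
  fixes S :: "('p::t2_space) frame"
  assumes A: "financial_model S U n A" and \<zeta>: "self_financing S U n A \<zeta>"
    and y: "is_path S y" and t: "t \<in> {initial S<..final S}"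
  shows "drift S (discounted_value n A \<zeta>) y t =
    (\<Sum>k\<le>n. \<zeta> k (frozen t y) t * drift S (discounted A k) y t)"
proof (cases "t \<in> grid S")
  case False
  note D = process_has_derivative[OF _ y t False]
  have "((\<lambda>s. discounted_value n A \<zeta> (frozen t y) s) has_real_derivative
      (\<Sum>k\<le>n. drift S (\<zeta> k) y t * discounted A k (frozen t y) t
        + drift S (discounted A k) y t * \<zeta> k (frozen t y) t)) (at t)"
    unfolding discounted_value_def using \<zeta> process_discounted[OF A]
    by (intro DERIV_sum DERIV_mult D) (auto simp: self_financing_def)
  then have "drift S (discounted_value n A \<zeta>) y t =
      (\<Sum>k\<le>n. drift S (\<zeta> k) y t * discounted A k (frozen t y) t
        + drift S (discounted A k) y t * \<zeta> k (frozen t y) t)"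
    using False by (simp add: drift_def DERIV_imp_deriv)
  also have "\<dots> = (\<Sum>k\<le>n. drift S (discounted A k) y t * \<zeta> k (frozen t y) t)"
    using \<zeta> y t by (simp add: sum.distrib self_financing_def)
  finally show ?thesis
    by (simp add: mult.commute)
qed (simp add: drift_def)

lemma jump_discounted_value:
  assumes \<zeta>: "self_financing S U n A \<zeta>" and y: "is_path S y" and t: "t \<in> {initial S<..final S}"
    and b: "b \<in> attainable S U t (left_lim y t)"
  shows "jump (discounted_value n A \<zeta>) y t b =
    (\<Sum>k\<le>n. \<zeta> k (frozen t y) t * jump (discounted A k) y t b)"
proof -
  have "jump (discounted_value n A \<zeta>) y t b =
      (\<Sum>k\<le>n. jump (\<zeta> k) y t b * discounted A k (Ext t y b) t) +
      (\<Sum>k\<le>n. \<zeta> k (frozen t y) t * jump (discounted A k) y t b)"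
    by (simp add: jump_def discounted_value_def algebra_simps sum_subtractf flip: sum.distrib)
  then show ?thesis
    using \<zeta> y t b by (simp add: self_financing_def)
qed


section \<open>An equivalent martingale measure excludes arbitrage\<close>

lemma equivalent_attainable:
  fixes S :: "('p::t2_space) frame"
  assumes "equivalent S U U'" and "is_path S y" and "t \<in> {initial S<..final S}"
  shows "{b \<in> lattice S. 0 < kernel S U' t (left_lim y t) b} = attainable S U t (left_lim y t)"
  using assms left_lim_in_lattice[OF assms(2,3)] by (simp add: equivalent_def attainable_def)

lemma martingale_equation:
  fixes S :: "('p::t2_space) frame"
  assumes "equivalent S U U'" and "martingale S U' F"
    and "is_path S y" and "t \<in> {initial S<..final S}"
  shows "drift S F y t + (\<Sum>b\<in>attainable S U t (left_lim y t).
    kernel S U' t (left_lim y t) b * jump F y t b) = 0"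
  using assms(2-4) unfolding martingale_def martingale_wrt_def
    equivalent_attainable[OF assms(1,3,4), symmetric] by blast

lemma martingale_discounted_value:
  fixes S :: "('p::t2_space) frame"
  assumes A: "financial_model S U n A" and eq: "equivalent S U U'"
    and mart: "\<forall>k\<le>n. martingale S U' (discounted A k)" and \<zeta>: "self_financing S U n A \<zeta>"
  shows "martingale S U' (discounted_value n A \<zeta>)"
  unfolding martingale_def martingale_wrt_def
proof (intro conjI allI impI)
  show "process S (discounted_value n A \<zeta>)"
    using process_discounted_value[OF A \<zeta>] .
next
  fix y t
  assume y: "is_path S y" and t: "t \<in> {initial S<..final S}"
  let ?D = "attainable S U t (left_lim y t)"
  let ?K = "kernel S U' t (left_lim y t)"
  let ?\<theta> = "\<lambda>k. \<zeta> k (frozen t y) t"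
  note D = equivalent_attainable[OF eq y t]
  have "drift S (discounted A k) y t + (\<Sum>b\<in>?D. ?K b * jump (discounted A k) y t b) = 0"
    if "k \<le> n" for k
    using martingale_equation[OF eq _ y t] mart that by blast
  then have "(\<Sum>k\<le>n. ?\<theta> k *
      (drift S (discounted A k) y t + (\<Sum>b\<in>?D. ?K b * jump (discounted A k) y t b))) = 0"
    by simp
  moreover have "(\<Sum>b\<in>?D. ?K b * jump (discounted_value n A \<zeta>) y t b) =
      (\<Sum>k\<le>n. \<Sum>b\<in>?D. ?\<theta> k * (?K b * jump (discounted A k) y t b))"
    by (subst sum.swap)
      (simp add: jump_discounted_value[OF \<zeta> y t] sum_distrib_left mult.left_commute)
  ultimately show "drift S (discounted_value n A \<zeta>) y t +
      (\<Sum>b\<in>{b \<in> lattice S. 0 < ?K b}. ?K b * jump (discounted_value n A \<zeta>) y t b) = 0"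
    unfolding D drift_discounted_value[OF A \<zeta> y t]
    by (simp add: distrib_left sum.distrib sum_distrib_left)
qed

lemma martingale_not_increasing:
  fixes S :: "('p::t2_space) frame"
  assumes fin: "finite (lattice S)" and eq: "equivalent S U U'" and mart: "martingale S U' F"
    and y: "is_path S y" and t: "t \<in> {initial S<..final S}"
  shows "\<not> increasing_at S U F y t"
proof
  let ?D = "attainable S U t (left_lim y t)"
  let ?K = "kernel S U' t (left_lim y t)"
  note D = equivalent_attainable[OF eq y t]
  assume inc: "increasing_at S U F y t"
  have zero: "drift S F y t + (\<Sum>b\<in>?D. ?K b * jump F y t b) = 0"
    using martingale_equation[OF eq mart y t] .
  have fin_D: "finite ?D"
    using fin by (simp add: attainable_def)
  have K: "0 < ?K b" if "b \<in> ?D" for b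
    using that unfolding D[symmetric] by simp
  have drift: "0 \<le> drift S F y t" and jump: "\<And>b. b \<in> ?D \<Longrightarrow> 0 \<le> ?K b * jump F y t b"
    using inc K by (auto simp: increasing_at_def nondecreasing_at_def less_imp_le)
  have sum: "0 \<le> (\<Sum>b\<in>?D. ?K b * jump F y t b)"
    using jump by (rule sum_nonneg)
  then have "drift S F y t = 0" "(\<Sum>b\<in>?D. ?K b * jump F y t b) = 0"
    using zero drift by linarith+
  then have "\<forall>b\<in>?D. ?K b * jump F y t b = 0"
    using sum_nonneg_eq_0_iff[OF fin_D jump] by simp
  then show False
    using inc K \<open>drift S F y t = 0\<close> by (force simp: increasing_at_def)
qed


section \<open>Solutions of the martingale equation at one time\<close>

text \<open>The martingale equation for the prices at time \<open>t\<close>, multiplied by the normalising factor of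
  the measure change; at a grid time the first term vanishes together with the drift. In this form
  it is homogeneous in the increments and the same on and off the grid.\<close>

definition tilt ::
  "('p::t2_space) frame \<Rightarrow> 'p propagator \<Rightarrow> nat \<Rightarrow> (nat \<Rightarrow> 'p process) \<Rightarrow> 'p path \<Rightarrow> real \<Rightarrow>
     ('p \<Rightarrow> real) \<Rightarrow> bool" where
  "tilt S U n A y t H \<longleftrightarrow>
     (\<forall>b. if b \<in> insert (left_lim y t) (attainable S U t (left_lim y t)) then 0 < H b else H b = 0) \<and>
     (\<forall>k\<le>n. H (left_lim y t) * drift S (discounted A k) y t +
        (\<Sum>b\<in>attainable S U t (left_lim y t).
           kernel S U t (left_lim y t) b * H b * jump (discounted A k) y t b) = 0)"

text \<open>The relation between two paths in the definition of a state-dependent model.\<close>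

definition proportional ::
  "('p::t2_space) frame \<Rightarrow> 'p propagator \<Rightarrow> nat \<Rightarrow> (nat \<Rightarrow> 'p process) \<Rightarrow> real \<Rightarrow> 'p path \<Rightarrow>
     'p path \<Rightarrow> bool" where
  "proportional S U n A t y y' \<longleftrightarrow> left_lim y t = left_lim y' t \<and>
     (\<exists>c>0. \<forall>k\<le>n. drift S (discounted A k) y t = c * drift S (discounted A k) y' t \<and>
        (\<forall>b\<in>attainable S U t (left_lim y t).
           jump (discounted A k) y t b = c * jump (discounted A k) y' t b))"

lemma tilt_cong:
  assumes "proportional S U n A t y y'"
  shows "tilt S U n A y t = tilt S U n A y' t"
proof
  fix H
  let ?a = "left_lim y' t"
  let ?E = "\<lambda>y k. H ?a * drift S (discounted A k) y t +
    (\<Sum>b\<in>attainable S U t ?a. kernel S U t ?a b * H b * jump (discounted A k) y t b)"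
  obtain c where a: "left_lim y t = ?a" and "c > 0"
    and c: "\<And>k. k \<le> n \<Longrightarrow> drift S (discounted A k) y t = c * drift S (discounted A k) y' t"
      "\<And>k b. k \<le> n \<Longrightarrow> b \<in> attainable S U t ?a \<Longrightarrow>
        jump (discounted A k) y t b = c * jump (discounted A k) y' t b"
    using assms unfolding proportional_def by metis
  have "?E y k = c * ?E y' k" if "k \<le> n" for k
    using c that by (simp add: distrib_left sum_distrib_left mult.left_commute)
  then have "?E y k = 0 \<longleftrightarrow> ?E y' k = 0" if "k \<le> n" for k
    using that \<open>c > 0\<close> by simp
  then show "tilt S U n A y t H = tilt S U n A y' t H"
    unfolding tilt_def a by auto
qed

lemma proportional_if_equal_before:
  fixes S :: "('p::t2_space) frame"
  assumes A: "financial_model S U n A" and y: "is_path S y" "is_path S y'"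
    and t: "t \<in> {initial S<..final S}" and eq: "\<forall>s\<in>{initial S..<t}. y s = y' s"
  shows "proportional S U n A t y y'"
proof -
  have "adapted S (discounted A k)" if "k \<le> n" for k
    using process_discounted[OF A that] by (simp add: process_def)
  note cong = increments_cong[OF this y t eq]
  show ?thesis
    unfolding proportional_def using left_lim_cong[OF y t eq] cong
    by (intro conjI exI[of _ 1]) (auto simp: attainable_def)
qed

lemma self_financing_const: "self_financing S U n A (\<lambda>k _ _. \<theta> k)"
proof -
  have "drift S (\<lambda>_ _. c) y t = 0" for c and y :: "'a path" and t
    by (simp add: drift_def)
  then show ?thesis
    by (simp add: self_financing_def process_const jump_def)
qed

text \<open>Constant strategies realise every vector of coefficients, so Stiemke's alternative applies
  to the increments, indexed by \<open>None\<close> for the drift and by \<open>Some b\<close> for the jump to \<open>b\<close>.\<close>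

lemma tilt_exists:
  fixes S :: "('p::t2_space) frame"
  assumes fin: "finite (lattice S)" and A: "financial_model S U n A" and na: "no_arbitrage S U n A"
    and y: "is_path S y" and t: "t \<in> {initial S<..final S}"
  shows "\<exists>H. tilt S U n A y t H"
proof -
  let ?a = "left_lim y t"
  let ?D = "attainable S U t ?a"
  let ?I = "insert None (Some ` ?D)"
  define v where "v i k = (case i of None \<Rightarrow> drift S (discounted A k) y t
    | Some b \<Rightarrow> jump (discounted A k) y t b)" for i k
  have fin_D: "finite ?D"
    using fin by (simp add: attainable_def)
  have "\<exists>w. (\<forall>i\<in>?I. 0 < w i) \<and> (\<forall>k\<in>{..n}. (\<Sum>i\<in>?I. w i * v i k) = 0)"
  proof (rule stiemke)
    show "finite ?I"
      using fin_D by simp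
    show "finite {..n}"
      by simp
  next
    fix \<theta> i
    assume nonneg: "\<And>i. i \<in> ?I \<Longrightarrow> 0 \<le> (\<Sum>k\<le>n. \<theta> k * v i k)" and i: "i \<in> ?I"
    define V where "V = discounted_value n A (\<lambda>k _ _. \<theta> k)"
    have drift: "drift S V y t = (\<Sum>k\<le>n. \<theta> k * v None k)"
      using drift_discounted_value[OF A self_financing_const y t] by (simp add: V_def v_def)
    have jump: "jump V y t b = (\<Sum>k\<le>n. \<theta> k * v (Some b) k)" if "b \<in> ?D" for b
      using jump_discounted_value[OF self_financing_const y t that] by (simp add: V_def v_def)
    have "\<not> increasing_at S U V y t"
      using na y t self_financing_const unfolding no_arbitrage_def arbitrage_at_def V_def by blast
    moreover have "nondecreasing_at S U V y t"
      using nonneg drift jump by (auto simp: nondecreasing_at_def)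
    ultimately have "drift S V y t \<le> 0" "\<forall>b\<in>?D. jump V y t b \<le> 0"
      by (auto simp: increasing_at_def not_less)
    then show "(\<Sum>k\<le>n. \<theta> k * v i k) \<le> 0"
      using i drift jump by auto
  qed
  then obtain w where w: "\<And>i. i \<in> ?I \<Longrightarrow> 0 < w i"
    "\<And>k. k \<le> n \<Longrightarrow> (\<Sum>i\<in>?I. w i * v i k) = 0"
    by auto
  define H where "H b = (if b = ?a then w None
    else if b \<in> ?D then w (Some b) / kernel S U t ?a b else 0)" for b
  have "tilt S U n A y t H"
    unfolding tilt_def
  proof (intro conjI allI impI)
    fix b
    show "if b \<in> insert ?a ?D then 0 < H b else H b = 0"
      using w(1) by (auto simp: H_def attainable_def)
  next
    fix k
    assume "k \<le> n"
    \<comment> \<open>The current point may be attainable at a grid time, but the jump to it vanishes.\<close>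
    have term_eq: "kernel S U t ?a b * H b * jump (discounted A k) y t b = w (Some b) * v (Some b) k"
      if "b \<in> ?D" for b
      using that by (auto simp: H_def v_def attainable_def jump_left_lim)
    have "(\<Sum>b\<in>?D. kernel S U t ?a b * H b * jump (discounted A k) y t b) =
        (\<Sum>b\<in>?D. w (Some b) * v (Some b) k)"
      using term_eq by (rule sum.cong[OF refl])
    moreover have "(\<Sum>i\<in>?I. w i * v i k) = w None * v None k + (\<Sum>b\<in>?D. w (Some b) * v (Some b) k)"
      using fin_D by (simp add: sum.reindex image_iff)
    ultimately show "H ?a * drift S (discounted A k) y t +
        (\<Sum>b\<in>?D. kernel S U t ?a b * H b * jump (discounted A k) y t b) = 0"
      using w(2)[OF \<open>k \<le> n\<close>] by (simp add: H_def[of ?a] v_def[of None])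
  qed
  then show ?thesis
    by blast
qed


section \<open>The changed kernel\<close>

lemma stochastic_kernel:
  assumes U: "markov_propagator S U" and t: "t \<in> {initial S<..final S}" "t \<in> grid S"
  shows "stochastic_matrix (lattice S) (kernel S U t)"
proof -
  obtain j where "j \<le> steps S" "t = times S j"
    using t(2) by (auto simp: grid_def)
  \<comment> \<open>A propagator has stochastic matrices at the times with index at least one.\<close>
  moreover from this have "j \<noteq> 0"
    using t(1) by (cases j) auto
  moreover have fin: "finite {i. i \<le> steps S \<and> times S i \<le> t}"
    by simp
  ultimately have "j \<le> last_grid S t" "last_grid S t \<le> steps S"
    unfolding last_grid_def by (auto intro!: Max_ge Max.boundedI)
  with \<open>j \<noteq> 0\<close> have "last_grid S t \<in> {1..steps S}"
    by auto
  then show ?thesis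
    using U t(2) by (simp add: markov_propagator_def kernel_def)
qed

lemma normaliser_pos:
  fixes P :: "'p \<Rightarrow> 'p \<Rightarrow> real"
  assumes fin: "finite X" and P: "stochastic_matrix X P" and "a \<in> X"
    and H: "\<And>b. b \<in> X \<Longrightarrow> 0 \<le> H b" "\<And>b. b \<in> X \<Longrightarrow> 0 < P a b \<Longrightarrow> 0 < H b"
  shows "0 < (\<Sum>b\<in>X. P a b * H b)"
proof -
  have nonneg: "0 \<le> P a b" if "b \<in> X" for b
    using P \<open>a \<in> X\<close> that by (simp add: stochastic_matrix_def)
  have "(\<Sum>b\<in>X. P a b) = 1"
    using P \<open>a \<in> X\<close> by (simp add: stochastic_matrix_def)
  then obtain b where "b \<in> X" "P a b \<noteq> 0"
    by (metis sum.neutral zero_neq_one)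
  then have "0 < P a b * H b"
    using nonneg H(2) by (simp add: less_le)
  then show ?thesis
    using \<open>b \<in> X\<close> nonneg H(1) by (intro sum_pos2[OF fin]) auto
qed

text \<open>Up to the term at the current point, which no jump sees, the changed kernel is the reweighted
  kernel divided by a positive normaliser.\<close>

lemma changed_kernel_martingale:
  fixes S :: "('p::t2_space) frame"
  assumes fin: "finite (lattice S)" and U: "markov_propagator S U"
    and y: "is_path S y" and t: "t \<in> {initial S<..final S}"
    and G: "tilt S U n A y t (G y t)" and "k \<le> n"
  shows "drift S (discounted A k) y t +
    (\<Sum>b\<in>{b \<in> lattice S. 0 < changed_kernel S U G y t (left_lim y t) b}.
      changed_kernel S U G y t (left_lim y t) b * jump (discounted A k) y t b) = 0"
proof -
  let ?a = "left_lim y t"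
  let ?D = "attainable S U t ?a"
  let ?K = "kernel S U t ?a"
  let ?K' = "changed_kernel S U G y t ?a"
  let ?J = "jump (discounted A k) y t"
  define H where "H = G y t"
  have H: "\<And>b. b \<in> insert ?a ?D \<Longrightarrow> 0 < H b" "\<And>b. b \<notin> insert ?a ?D \<Longrightarrow> H b = 0"
    and eq: "H ?a * drift S (discounted A k) y t + (\<Sum>b\<in>?D. ?K b * H b * ?J b) = 0"
    using G \<open>k \<le> n\<close> unfolding tilt_def H_def[symmetric] by metis+
  have H_nonneg: "0 \<le> H b" for b
    using H(1)[of b] H(2)[of b] by (cases "b \<in> insert ?a ?D") auto
  define Z where "Z = (if t \<in> grid S then \<Sum>c\<in>lattice S. ?K c * H c else H ?a)"
  have "0 < Z"
  proof (cases "t \<in> grid S")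
    case True
    then show ?thesis
      using normaliser_pos[OF fin stochastic_kernel[OF U t True] left_lim_in_lattice[OF y t]]
        H H_nonneg by (auto simp: Z_def attainable_def)
  next
    case False
    then show ?thesis
      using H(1)[of ?a] by (simp add: Z_def)
  qed
  have K': "?K' b = ?K b * H b / Z" if "b \<noteq> ?a" for b
    using that by (simp add: changed_kernel_def Z_def H_def)
  have term_eq: "?K' b * ?J b = ?K b * H b * ?J b / Z" for b
    using K'[of b] by (cases "b = ?a") (auto simp: jump_left_lim)
  have outside: "?K b * H b * ?J b = 0" if "b \<in> lattice S - ?D" for b
    using that H(2)[of b] by (cases "b = ?a") (auto simp: jump_left_lim)
  have "?K' b * ?J b = 0" if b: "b \<in> lattice S - {b \<in> lattice S. 0 < ?K' b}" for b
  proof (cases "b \<in> ?D \<and> b \<noteq> ?a")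
    case True
    then have "0 < ?K' b"
      using K' H(1) \<open>0 < Z\<close> by (simp add: attainable_def)
    then show ?thesis
      using b by simp
  next
    case False
    then show ?thesis
      using b outside[of b] unfolding term_eq by (auto simp: jump_left_lim)
  qed
  then have "(\<Sum>b\<in>{b \<in> lattice S. 0 < ?K' b}. ?K' b * ?J b) = (\<Sum>b\<in>lattice S. ?K' b * ?J b)"
    using fin by (intro sum.mono_neutral_left) auto
  also have "\<dots> = (\<Sum>b\<in>lattice S. ?K b * H b * ?J b) / Z"
    by (simp add: term_eq sum_divide_distrib)
  also have "(\<Sum>b\<in>lattice S. ?K b * H b * ?J b) = (\<Sum>b\<in>?D. ?K b * H b * ?J b)"
    using fin outside by (intro sum.mono_neutral_right) (auto simp: attainable_def)
  also have "\<dots> = - H ?a * drift S (discounted A k) y t"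
    using eq by simp
  also have "\<dots> / Z = - drift S (discounted A k) y t"
    using \<open>0 < Z\<close> by (auto simp: Z_def drift_def)
  finally show ?thesis
    by simp
qed

text \<open>The choice operator applied to the predicate \<open>tilt S U n A y t\<close> returns the same function for
  any two paths on which this predicate agrees. This is why adaptedness and state dependence come
  with the choice.\<close>

lemma measure_change_exists:
  fixes S :: "('p::t2_space) frame"
  assumes fin: "finite (lattice S)" and U: "markov_propagator S U"
    and A: "financial_model S U n A" and na: "no_arbitrage S U n A"
  shows "\<exists>G. measure_change S U G \<and>
    (\<forall>k\<le>n. martingale_wrt S (changed_kernel S U G) (discounted A k)) \<and>
    (state_dependent S U n A \<longrightarrow>
      (\<exists>g. \<forall>y t. is_path S y \<longrightarrow> t \<in> {initial S<..final S} \<longrightarrow> G y t = g (left_lim y t) t))"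
proof -
  define G where "G y t = (SOME H. tilt S U n A y t H)" for y t
  have G: "tilt S U n A y t (G y t)" if "is_path S y" "t \<in> {initial S<..final S}" for y t
    unfolding G_def using tilt_exists[OF fin A na that] by (rule someI_ex)
  have G_cong: "G y t = G y' t" if "proportional S U n A t y y'" for y y' t
    unfolding G_def tilt_cong[OF that] ..
  have "measure_change S U G"
    unfolding measure_change_def
    using G G_cong[OF proportional_if_equal_before[OF A]] unfolding tilt_def by blast
  moreover have "martingale_wrt S (changed_kernel S U G) (discounted A k)" if "k \<le> n" for k
    unfolding martingale_wrt_def
    by (intro conjI allI impI process_discounted[OF A that]
        changed_kernel_martingale[OF fin U _ _ _ that] G)
  moreover have "\<exists>g. \<forall>y t. is_path S y \<longrightarrow> t \<in> {initial S<..final S} \<longrightarrow> G y t = g (left_lim y t) t"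
    if sd: "state_dependent S U n A"
  proof -
    define r where "r a t = (SOME y. is_path S y \<and> left_lim y t = a)" for a t
    have "G y t = G (r (left_lim y t) t) t"
      if y: "is_path S y" and t: "t \<in> {initial S<..final S}" for y t
    proof (rule G_cong)
      have "is_path S (r (left_lim y t) t) \<and> left_lim (r (left_lim y t) t) t = left_lim y t"
        unfolding r_def by (rule someI[of _ y]) (simp add: y)
      then have r: "is_path S (r (left_lim y t) t)" "left_lim y t = left_lim (r (left_lim y t) t) t"
        by simp_all
      show "proportional S U n A t y (r (left_lim y t) t)"
        unfolding proportional_def
        using r(2) sd[unfolded state_dependent_def, rule_format, OF y r(1) t r(2)] by (rule conjI)
    qed
    then show ?thesis
      by (intro exI[of _ "\<lambda>a t. G (r a t) t"]) blast
  qed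
  ultimately show ?thesis
    by blast
qed


section \<open>The fundamental theorem of finance\<close>

theorem theorem10:
  fixes S :: "(real ^ 'd) frame" and U :: "(real ^ 'd) propagator"
    and A :: "nat \<Rightarrow> (real ^ 'd) process" and m n :: nat
  assumes "frame m S" and "markov_propagator S U" and "financial_model S U n A"
  shows "(\<forall>U'. markov_propagator S U' \<longrightarrow> equivalent S U U' \<longrightarrow>
            (\<forall>k\<le>n. martingale S U' (discounted A k)) \<longrightarrow>
            (\<forall>\<zeta>. self_financing S U n A \<zeta> \<longrightarrow> martingale S U' (discounted_value n A \<zeta>)) \<and>
            no_arbitrage S U n A)
       \<and> (no_arbitrage S U n A \<longrightarrow>
            (\<exists>G. measure_change S U G \<and>
               (\<forall>k\<le>n. martingale_wrt S (changed_kernel S U G) (discounted A k)) \<and>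
               (state_dependent S U n A \<longrightarrow>
                  (\<exists>g. \<forall>y t. is_path S y \<longrightarrow> t \<in> {initial S<..final S} \<longrightarrow>
                     G y t = g (left_lim y t) t))))"
proof -
  have fin: "finite (lattice S)"
    using assms(1) by (simp add: frame_def)
  show ?thesis
    using martingale_discounted_value[OF assms(3)] martingale_not_increasing[OF fin]
      measure_change_exists[OF fin assms(2,3)]
    unfolding no_arbitrage_def arbitrage_at_def by blast
qed

end
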